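(* Let $n_1,\ldots,n_r$ be positive integers, $N=n_1+\cdots+n_r$, $K$ a field, $S=K[x_1,\ldots,x_N]$, and $$I=(x_1,\ldots,x_{n_1})\cap(x_{n_1+1},\ldots,x_{n_1+n_2})\cap\cdots\cap(x_{n_1+\cdots+n_{r-1}+1},\ldots,x_N)\subset S.$$ Then: (1) $\operatorname{hdepth}(I)$ is the maximum of all integers $d$ such that $\left\lceil\frac{n_1}{2}\right\rceil+\cdots+\left\lceil\frac{n_r}{2}\right\rceil\leq d\leq\left\lfloor\frac{N+r}{2}\right\rfloor$ and $$\sum_{J\subseteq[r]}(-1)^{|J|}\binom{N-\sum_{i\in J}n_i-d+k-1}{k}\geq 0\quad\text{for all } r\leq k\leq d.$$ (2) $\operatorname{hdepth}(S/I)$ is the maximum of all integers $d$ such that $\left\lceil\frac{n_1}{2}\right\rceil+\cdots+\left\lceil\frac{n_r}{2}\right\rceil-\min_{1\leq i\leq r}\left\lceil\frac{n_i}{2}\right\rceil\leq d\leq N-\min_{1\leq i\leq r}n_i$ and $$\sum_{\emptyset\neq J\subseteq[r]}(-1)^{|J|+1}\binom{N-\sum_{i\in J}n_i-d+k-1}{k}\geq 0\quad\text{for all } r\leq k\leq d.$$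
   Context: Here $[r]=\{1,\ldots,r\}$, and $\binom{x}{k}=\frac{x(x-1)\cdots(x-k+1)}{k!}$ for any integer $x$ (possibly negative) and integer $k\geq 0$. Hilbert depth: let $S=K[x_1,\ldots,x_p]$. For a finitely generated graded $S$-module $M$, $\operatorname{hdepth}(M)$ is the maximal depth of a finitely generated graded $S$-module with the same Hilbert series as $M$. For squarefree monomial ideals $A\subset B\subset S$ this is (by a known theorem, usable as the definition) $\operatorname{hdepth}(B/A)=\max\{d\in\{0,\ldots,p\}:\beta_k^d(B/A)\geq 0\text{ for all }0\leq k\leq d\}$, where $\beta_k^d(B/A)=\sum_{j=0}^k(-1)^{k-j}\binom{d-j}{k-j}\alpha_j(B/A)$ and $\alpha_j(B/A)$ is the number of squarefree monomials of degree $j$ in $B\setminus A$ (for the ideal $I$ itself take $B=I$, $A=0$). *)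

theory Defs
  imports Complex_Main "HOL-Library.Poly_Mapping" "HOL-Algebra.Ideal"
begin

text \<open>Polynomials over \<open>'k\<close> in variables indexed by the natural numbers: exponent vectors are
  finitely supported maps \<^typ>\<open>nat \<Rightarrow>\<^sub>0 nat\<close>, polynomials finitely supported maps from exponent
  vectors to coefficients, multiplied by convolution.\<close>

type_synonym 'k mpoly = "(nat \<Rightarrow>\<^sub>0 nat) \<Rightarrow>\<^sub>0 'k"

definition var :: "nat \<Rightarrow> 'k::field mpoly"
  where "var i = Poly_Mapping.single (Poly_Mapping.single i 1) 1"

definition poly_ring :: "nat \<Rightarrow> 'k::field mpoly ring"
  where "poly_ring p =
    \<lparr>carrier = {f. \<forall>m\<in>Poly_Mapping.keys f. Poly_Mapping.keys m \<subseteq> {1..p}},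
     monoid.mult = (*), one = 1, zero = 0, add = (+)\<rparr>"

lemma cring_poly_ring: "cring (poly_ring p :: 'k::field mpoly ring)"
proof -
  let ?C = "{f :: 'k mpoly. \<forall>m\<in>Poly_Mapping.keys f. Poly_Mapping.keys m \<subseteq> {1..p}}"
  have add: "f + g \<in> ?C" if "f \<in> ?C" "g \<in> ?C" for f g
    using that keys_add[of f g] by blast
  have mult: "f * g \<in> ?C" if fg: "f \<in> ?C" "g \<in> ?C" for f g
  proof -
    have "Poly_Mapping.keys m \<subseteq> {1..p}" if m: "m \<in> Poly_Mapping.keys (f * g)" for m
    proof -
      obtain a b where "m = a + b" "a \<in> Poly_Mapping.keys f" "b \<in> Poly_Mapping.keys g"
        using m keys_mult[of f g] by blast
      then show ?thesis
        using fg keys_add[of a b] by blast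
    qed
    then show ?thesis by blast
  qed
  have neg: "- f \<in> ?C" if "f \<in> ?C" for f
    using that by (simp add: keys_minus)
  have simps: "carrier (poly_ring p) = ?C" "x \<otimes>\<^bsub>poly_ring p\<^esub> y = x * y" "\<one>\<^bsub>poly_ring p\<^esub> = (1 :: 'k mpoly)"
    "x \<oplus>\<^bsub>poly_ring p\<^esub> y = x + y" "\<zero>\<^bsub>poly_ring p\<^esub> = (0 :: 'k mpoly)" for x y :: "'k mpoly"
    by (simp_all add: poly_ring_def)
  have units: "0 \<in> ?C" "1 \<in> ?C"
    by simp_all
  show ?thesis
  proof (rule cringI)
    show "abelian_group (poly_ring p :: 'k mpoly ring)"
      by (rule abelian_groupI; unfold simps)
        (use add units neg in \<open>blast intro: add.assoc add.commute add_0_left left_minus\<close>)+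
    show "comm_monoid (poly_ring p :: 'k mpoly ring)"
      by (rule comm_monoidI; unfold simps)
        (use mult units in \<open>blast intro: mult.assoc mult.commute mult_1_left\<close>)+
  qed (unfold simps, rule distrib_right)
qed

definition sqfree_monomials :: "nat \<Rightarrow> nat \<Rightarrow> 'k::field mpoly set"
  where "sqfree_monomials p j = {\<Prod>i\<in>T. var i | T. T \<subseteq> {1..p} \<and> card T = j}"

definition alpha :: "nat \<Rightarrow> 'k::field mpoly set \<Rightarrow> 'k mpoly set \<Rightarrow> nat \<Rightarrow> nat"
  where "alpha p B A j = card (sqfree_monomials p j \<inter> (B - A))"

definition beta :: "nat \<Rightarrow> 'k::field mpoly set \<Rightarrow> 'k mpoly set \<Rightarrow> nat \<Rightarrow> nat \<Rightarrow> int"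
  where "beta p B A d k =
    (\<Sum>j=0..k. (-1) ^ (k - j) * int ((d - j) choose (k - j)) * int (alpha p B A j))"

text \<open>The Hilbert depth of \<open>B / A\<close> for squarefree monomial ideals \<open>A \<subseteq> B\<close> of
  \<open>'k[x\<^sub>1, \<dots>, x\<^sub>p]\<close>, by its combinatorial characterization. The set always contains \<open>0\<close>.\<close>

definition hdepth :: "nat \<Rightarrow> 'k::field mpoly set \<Rightarrow> 'k mpoly set \<Rightarrow> nat"
  where "hdepth p B A = Max {d \<in> {0..p}. \<forall>k\<le>d. beta p B A d k \<ge> 0}"

text \<open>The indices of the \<open>i\<close>-th block of consecutive variables (of length \<open>n i\<close>), for \<open>i \<ge> 1\<close>.\<close>

definition block :: "(nat \<Rightarrow> nat) \<Rightarrow> nat \<Rightarrow> nat set"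
  where "block n i = {(\<Sum>l=1..<i. n l) + 1 .. (\<Sum>l=1..i. n l)}"

text \<open>Unlike \<^const>\<open>Max\<close>, this asserts that the maximum exists.\<close>

definition is_maximum :: "int \<Rightarrow> int set \<Rightarrow> bool"
  where "is_maximum m D \<longleftrightarrow> m \<in> D \<and> (\<forall>d\<in>D. d \<le> m)"

end

theory Submission
  imports Defs "HOL-Library.Disjoint_Sets" "HOL-Computational_Algebra.Formal_Power_Series"
begin

text \<open>Put \<open>w = 1 - t\<close> and \<open>\<Phi>\<^sub>d = w\<^sup>d (w\<^bsup>-n\<^sub>1\<^esup> - 1) \<cdots> (w\<^bsup>-n\<^sub>r\<^esup> - 1)\<close>.
  By inclusion-exclusion and Vandermonde's identity, \<open>\<beta>\<^sub>k\<^sup>d\<close> is for \<open>k \<le> d\<close> the coefficient of \<open>t\<^sup>k\<close>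
  in \<open>\<Phi>\<^sub>d\<close> for the ideal and in \<open>w\<^bsup>d-N\<^esup> - \<Phi>\<^sub>d\<close> for the quotient; these coefficients are the sums in
  the theorem. Only the bounds on \<open>d\<close> remain. Let \<open>c\<^sub>i\<close> and \<open>e\<^sub>i\<close> be the upper and lower
  halves of \<open>n\<^sub>i\<close> and \<open>f\<^sub>i = w\<^sup>-\<^sup>e - w\<^sup>c\<close> with \<open>e = e\<^sub>i\<close>, \<open>c = c\<^sub>i\<close>, which has nonnegative coefficients.

  Ideal: for \<open>d = \<Sum> c\<^sub>i\<close> the series \<open>\<Phi>\<^sub>d\<close> is the product of the \<open>f\<^sub>i\<close>; conversely the coefficient of
  \<open>t\<^bsup>r+1\<^esup>\<close> in \<open>\<Phi>\<^sub>d\<close> is a positive multiple of \<open>N + r - 2d\<close>.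

  Quotient: coefficientwise \<open>f\<^sub>i (w\<^sup>-\<^sup>M - 1) \<le> w\<^bsup>-M-e\<^esup> - 1\<close> for all \<open>M \<ge> 0\<close>. Starting from
  \<open>M = n\<^sub>a\<close>, a minimal \<open>n\<^sub>i\<close>, and multiplying by all \<open>f\<^sub>i\<close> with \<open>i \<noteq> a\<close> gives \<open>\<Phi>\<^sub>d \<le> w\<^bsup>d-N\<^esup> - 1\<close> for \<open>d = \<Sum>\<^bsub>i\<noteq>a\<^esub> c\<^sub>i\<close>.
  Conversely \<open>\<beta>\<^sub>0\<^sup>d = 1\<close> and \<open>\<Sum>\<^bsub>k\<le>d\<^esub> \<beta>\<^sub>k\<^sup>d\<close> is the number \<open>\<alpha>\<^sub>d\<close> of squarefree monomials of degree \<open>d\<close>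
  outside the ideal, so nonnegative \<open>\<beta>\<^sub>k\<^sup>d\<close> force such a monomial to exist.\<close>

section \<open>Powers of \<open>1 - t\<close> with integer exponents\<close>

definition one_minus_X_power :: "int \<Rightarrow> real fps" ("W")
  where "W a = Abs_fps (\<lambda>k. (-1) ^ k * (of_int a gchoose k))"

lemma W_nth: "fps_nth (W a) k = (-1) ^ k * (of_int a gchoose k)"
  by (simp add: one_minus_X_power_def)

text \<open>Negating the upper index absorbs the sign. This is the shape of the binomials in the
  theorem, and for \<open>a < 0\<close> it makes the coefficients visibly nonnegative.\<close>

lemma W_nth': "fps_nth (W a) k = of_int (int k - a - 1) gchoose k"
proof -
  have "fps_nth (W a) k = (-1) ^ k * ((-1) ^ k * (real k - of_int a - 1 gchoose k))"
    unfolding W_nth by (subst gbinomial_negated_upper) simp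
  also have "\<dots> = real k - of_int a - 1 gchoose k"
    by (cases "even k") simp_all
  finally show ?thesis by simp
qed

lemma W_nth_0 [simp]: "fps_nth (W a) 0 = 1"
  by (simp add: W_nth)

lemma W_nth_1: "fps_nth (W a) (Suc 0) = - of_int a"
  by (simp add: W_nth)

lemma W_0 [simp]: "W 0 = 1"
  by (rule fps_ext) (simp add: W_nth gbinomial_0_left)

text \<open>Vandermonde's identity, read as the exponent law.\<close>

lemma W_add: "W (a + b) = W a * W b"
proof (rule fps_ext)
  fix k
  have "fps_nth (W a * W b) k
      = (\<Sum>i=0..k. (-1) ^ k * ((of_int a gchoose i) * (of_int b gchoose (k - i))))"
    by (auto simp: fps_mult_nth W_nth simp flip: power_add intro!: sum.cong)
  also have "\<dots> = (-1) ^ k * (of_int (a + b) gchoose k)"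
    using gbinomial_Vandermonde[of "of_int a :: real" "of_int b" k]
    by (simp flip: sum_distrib_left)
  finally show "fps_nth (W (a + b)) k = fps_nth (W a * W b) k"
    by (simp add: W_nth)
qed

lemma W_sum: "W (\<Sum>i\<in>A. f i) = (\<Prod>i\<in>A. W (f i))"
  by (induction A rule: infinite_finite_induct) (simp_all add: W_add)

lemma W_nat_nth: "fps_nth (W (int c)) k = (-1) ^ k * real (c choose k)"
  by (simp add: W_nth binomial_gbinomial)

text \<open>The degree is a successor because the upper index \<open>e + k - 1\<close> in degree
  \<open>k\<close> would involve truncated subtraction.\<close>

lemma W_neg_nth_Suc: "fps_nth (W (- int e)) (Suc k) = real ((e + k) choose Suc k)"
  by (simp add: W_nth' binomial_gbinomial add.commute)

section \<open>Series with nonnegative coefficients\<close>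

definition nonneg_fps :: "real fps \<Rightarrow> bool"
  where "nonneg_fps F \<longleftrightarrow> (\<forall>k. 0 \<le> fps_nth F k)"

lemma nonneg_fps_1: "nonneg_fps 1"
  by (simp add: nonneg_fps_def)

lemma nonneg_fps_add: "nonneg_fps F \<Longrightarrow> nonneg_fps G \<Longrightarrow> nonneg_fps (F + G)"
  by (simp add: nonneg_fps_def)

lemma nonneg_fps_mult: "nonneg_fps F \<Longrightarrow> nonneg_fps G \<Longrightarrow> nonneg_fps (F * G)"
  by (simp add: nonneg_fps_def fps_mult_nth sum_nonneg)

lemma nonneg_fps_prod: "(\<And>i. i \<in> A \<Longrightarrow> nonneg_fps (F i)) \<Longrightarrow> nonneg_fps (\<Prod>i\<in>A. F i)"
  by (induction A rule: infinite_finite_induct) (simp_all add: nonneg_fps_1 nonneg_fps_mult)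

text \<open>The upper indices satisfy \<open>c \<le> Suc e \<le> e + k\<close>. For
  \<open>k = 0\<close> the claim fails when \<open>c = Suc e\<close>, but the comparison is called
  for only in even degrees \<open>Suc k\<close>.\<close>

lemma choose_le_shifted_choose:
  assumes "c \<le> Suc e" "0 < k"
  shows "c choose Suc k \<le> (e + k) choose Suc k"
  using assms by (intro binomial_right_mono) simp

text \<open>The constant terms cancel. In odd degrees \<open>- W (int c)\<close> has nonnegative
  coefficients itself; in even degrees \<open>W (- int e)\<close> dominates
  \<open>W (int c)\<close>.\<close>

lemma nonneg_fps_factor:
  assumes "c \<le> Suc e"
  shows "nonneg_fps (W (- int e) - W (int c))"
  unfolding nonneg_fps_def
proof
  fix k
  show "0 \<le> fps_nth (W (- int e) - W (int c)) k"
  proof (cases k)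
    case (Suc j)
    show ?thesis
    proof (cases "even j")
      case True
      then show ?thesis by (simp add: Suc W_neg_nth_Suc W_nat_nth)
    next
      case False
      then have "0 < j" by (cases j) auto
      from choose_le_shifted_choose[OF assms this] False show ?thesis
        by (simp add: Suc W_neg_nth_Suc W_nat_nth)
    qed
  qed simp
qed

text \<open>In the even degrees the first term dominates the third one, in the odd degrees the third one
  dominates the second one.\<close>

lemma nonneg_fps_slack:
  assumes "c \<le> Suc e"
  shows "nonneg_fps (W (- int e) + W (int c - int M) - W (int c) - 1)"
  unfolding nonneg_fps_def
proof
  fix k
  show "0 \<le> fps_nth (W (- int e) + W (int c - int M) - W (int c) - 1) k"
  proof (cases k)
    case 0
    then show ?thesis by simp
  next
    case (Suc j)
    show ?thesis
    proof (cases "M \<le> c")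
      case True
      then obtain m where "c = M + m" using le_Suc_ex by blast
      then have eq: "int c - int M = int m" and "m \<le> c" by simp_all
      show ?thesis
      proof (cases "even j")
        case True
        have "m choose Suc j \<le> c choose Suc j"
          using \<open>m \<le> c\<close> by (rule binomial_right_mono)
        with True show ?thesis
          by (simp add: Suc W_neg_nth_Suc W_nat_nth eq)
      next
        case False
        then have "0 < j" by (cases j) auto
        from choose_le_shifted_choose[OF assms this] False show ?thesis
          by (simp add: Suc W_neg_nth_Suc W_nat_nth eq)
      qed
    next
      case False
      then obtain m where "M = c + m" using le_Suc_ex[of c M] by auto
      then have eq: "int c - int M = - int m" by simp
      have "0 \<le> fps_nth (W (int c - int M)) k"
        unfolding eq by (simp add: Suc W_neg_nth_Suc)
      moreover have "0 \<le> fps_nth (W (- int e) - W (int c)) k"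
        using nonneg_fps_factor[OF assms] by (simp add: nonneg_fps_def)
      ultimately show ?thesis by (simp add: Suc)
    qed
  qed
qed

text \<open>Induction on \<open>A\<close>, with \<open>E\<close> the exponent reached so far.
  Multiplying the induction hypothesis by the new nonnegative factor \<open>f\<close> leaves the
  remainder \<open>W (- e - E) - 1 - f * (W (- E) - 1)\<close>, which is exactly the series of
  \<open>nonneg_fps_slack\<close> with \<open>E\<close> in place of \<open>M\<close>.\<close>

lemma nonneg_fps_product_bound:
  assumes "finite A" "\<And>i. i \<in> A \<Longrightarrow> c i \<le> Suc (e i)"
  shows "nonneg_fps (W (- int (M + (\<Sum>i\<in>A. e i))) - 1
           - (W (- int M) - 1) * (\<Prod>i\<in>A. W (- int (e i)) - W (int (c i))))"
  using assms
proof (induction A rule: finite_induct)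
  case empty
  then show ?case by (simp add: nonneg_fps_def)
next
  case (insert x A)
  define E where "E = M + (\<Sum>i\<in>A. e i)"
  define P where "P = (\<Prod>i\<in>A. W (- int (e i)) - W (int (c i)))"
  let ?f = "W (- int (e x)) - W (int (c x))"
  have IH: "nonneg_fps (W (- int E) - 1 - (W (- int M) - 1) * P)"
    using insert by (simp add: E_def P_def)
  have f: "nonneg_fps ?f" "nonneg_fps (W (- int (e x)) + W (int (c x) - int E) - W (int (c x)) - 1)"
    using insert.prems by (intro nonneg_fps_factor nonneg_fps_slack; simp)+
  have "- int (M + (\<Sum>i\<in>insert x A. e i)) = - int (e x) + - int E"
    using insert.hyps by (simp add: E_def)
  then have "W (- int (M + (\<Sum>i\<in>insert x A. e i))) = W (- int (e x)) * W (- int E)"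
    by (simp only: W_add)
  moreover have "W (int (c x) - int E) = W (int (c x)) * W (- int E)"
    by (simp flip: W_add)
  ultimately have "W (- int (M + (\<Sum>i\<in>insert x A. e i))) - 1
      - (W (- int M) - 1) * (\<Prod>i\<in>insert x A. W (- int (e i)) - W (int (c i)))
    = ?f * (W (- int E) - 1 - (W (- int M) - 1) * P)
      + (W (- int (e x)) + W (int (c x) - int E) - W (int (c x)) - 1)"
    using insert.hyps by (simp add: P_def algebra_simps)
  then show ?case
    using nonneg_fps_add[OF nonneg_fps_mult[OF f(1) IH] f(2)] by (simp only:)
qed

section \<open>The alternating binomial transform and the series
  \<open>\<Phi>\<^sub>d\<close>\<close>

text \<open>Upper negation turns the signed binomial into
  \<open>(k - d - 1) gchoose (k - j)\<close>, whose upper index is free of \<open>j\<close>, so that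
  Vandermonde's identity sums the series. The hypothesis \<open>k \<le> d\<close> keeps
  \<open>d - j\<close> from being truncated.\<close>

lemma binomial_convolution:
  assumes "k \<le> d"
  shows "(\<Sum>j=0..k. (-1) ^ (k - j) * real ((d - j) choose (k - j)) * real (m choose j))
    = fps_nth (W (int d - int m)) k"
proof -
  have "(-1) ^ (k - j) * real ((d - j) choose (k - j)) = (real k - real d - 1) gchoose (k - j)"
    if "j \<le> k" for j
  proof -
    define i where "i = k - j"
    have "real k - real d - 1 = - (real (d - j) - real i + 1)"
      using that assms by (simp add: i_def)
    then have "(real k - real d - 1) gchoose i
        = (-1) ^ i * (real (d - j) - real i + 1 + real i - 1 gchoose i)"
      by (simp only: gbinomial_minus)
    then show ?thesis
      by (simp add: binomial_gbinomial i_def)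
  qed
  then have "(\<Sum>j=0..k. (-1) ^ (k - j) * real ((d - j) choose (k - j)) * real (m choose j))
    = (\<Sum>j=0..k. (real m gchoose j) * ((real k - real d - 1) gchoose (k - j)))"
    by (intro sum.cong) (simp_all add: binomial_gbinomial)
  also have "\<dots> = (real m + (real k - real d - 1)) gchoose k"
    by (simp add: gbinomial_Vandermonde)
  finally show ?thesis
    by (simp add: W_nth' algebra_simps)
qed

text \<open>The part of \<open>\<Phi>\<^sub>d\<close> that does not depend on \<open>d\<close>:
  \<open>W d * numerator_series {1..r} n\<close> is \<open>\<Phi>\<^sub>d\<close>.\<close>

definition numerator_series :: "nat set \<Rightarrow> (nat \<Rightarrow> nat) \<Rightarrow> real fps"
  where "numerator_series A n = (\<Prod>i\<in>A. W (- int (n i)) - 1)"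

text \<open>The product is multiplied out; \<open>J\<close> collects the factors that contribute
  \<open>-1\<close>, and the exponents of the others add up to the total minus the sum over
  \<open>J\<close>.\<close>

lemma numerator_series_expand:
  assumes "finite A"
  shows "W d * numerator_series A n
    = (\<Sum>J\<in>Pow A. (-1) ^ card J * W (d + (\<Sum>i\<in>J. int (n i)) - (\<Sum>i\<in>A. int (n i))))"
proof -
  have "numerator_series A n = (\<Sum>J\<in>Pow A. (-1) ^ card J * (\<Prod>i\<in>A - J. W (- int (n i))))"
    unfolding numerator_series_def prod_diff_conv_sum[OF assms] by simp
  also have "W d * \<dots> = (\<Sum>J\<in>Pow A. (-1) ^ card J * W (d + (\<Sum>i\<in>J. int (n i)) - (\<Sum>i\<in>A. int (n i))))"
    unfolding sum_distrib_left
  proof (rule sum.cong)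
    fix J assume "J \<in> Pow A"
    then have "(\<Sum>i\<in>A. int (n i)) = (\<Sum>i\<in>J. int (n i)) + (\<Sum>i\<in>A - J. int (n i))"
      using assms by (simp add: sum.subset_diff add.commute)
    then have "d + (\<Sum>i\<in>J. int (n i)) - (\<Sum>i\<in>A. int (n i)) = d + (\<Sum>i\<in>A - J. - int (n i))"
      by (simp add: sum_negf)
    then have "W (d + (\<Sum>i\<in>J. int (n i)) - (\<Sum>i\<in>A. int (n i)))
        = W d * (\<Prod>i\<in>A - J. W (- int (n i)))"
      by (simp only: W_add W_sum)
    then show "W d * ((-1) ^ card J * (\<Prod>i\<in>A - J. W (- int (n i))))
      = (-1) ^ card J * W (d + (\<Sum>i\<in>J. int (n i)) - (\<Sum>i\<in>A. int (n i)))"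
      by (simp only: mult.left_commute)
  qed simp
  finally show ?thesis .
qed

lemma numerator_series_nth:
  assumes "finite A"
  shows "fps_nth (W d * numerator_series A n) k
    = (\<Sum>J\<in>Pow A. (-1) ^ card J *
        (of_int ((\<Sum>i\<in>A. int (n i)) - (\<Sum>i\<in>J. int (n i)) - d + int k - 1) gchoose k))"
  unfolding numerator_series_expand[OF assms] fps_sum_nth
proof (rule sum.cong)
  fix J :: "nat set"
  show "fps_nth ((-1) ^ card J * W (d + (\<Sum>i\<in>J. int (n i)) - (\<Sum>i\<in>A. int (n i)))) k
    = (-1) ^ card J * (of_int ((\<Sum>i\<in>A. int (n i)) - (\<Sum>i\<in>J. int (n i)) - d + int k - 1) gchoose k)"
    by (cases "even (card J)") (simp_all add: W_nth' algebra_simps)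
qed simp

text \<open>The quotient of \<open>W (- int m) - 1\<close> by \<open>t\<close>; it exposes the power
  of \<open>t\<close> dividing \<open>\<Phi>\<^sub>d\<close>.\<close>

definition shifted_series :: "nat \<Rightarrow> real fps"
  where "shifted_series m = fps_shift 1 (W (- int m) - 1)"

lemma shifted_series: "W (- int m) - 1 = fps_X * shifted_series m"
  by (rule fps_ext) (simp add: shifted_series_def)

lemma shifted_series_nth_0: "fps_nth (shifted_series m) 0 = real m"
  by (simp add: shifted_series_def W_nth_1)

lemma shifted_series_nth_1: "fps_nth (shifted_series m) (Suc 0) = real m * (real m + 1) / 2"
proof -
  have "fps_nth (shifted_series m) (Suc 0) = (- real m) gchoose Suc (Suc 0)"
    by (simp add: shifted_series_def W_nth)
  then show ?thesis
    using gbinomial_absorption[of "Suc 0" "- real m"] by (simp add: algebra_simps)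
qed

text \<open>Each factor begins with \<open>m * (1 + (m + 1) / 2 * t)\<close>, so in the product the
  terms \<open>(m + 1) / 2\<close> add up.\<close>

lemma shifted_series_prod:
  assumes "finite A"
  shows "fps_nth (\<Prod>i\<in>A. shifted_series (n i)) 0 = (\<Prod>i\<in>A. real (n i))"
    and "fps_nth (\<Prod>i\<in>A. shifted_series (n i)) (Suc 0)
      = (\<Prod>i\<in>A. real (n i)) * (\<Sum>i\<in>A. real (n i) + 1) / 2"
proof -
  show *: "fps_nth (\<Prod>i\<in>A. shifted_series (n i)) 0 = (\<Prod>i\<in>A. real (n i))" for A
    by (induction A rule: infinite_finite_induct) (simp_all add: shifted_series_nth_0)
  show "fps_nth (\<Prod>i\<in>A. shifted_series (n i)) (Suc 0)
      = (\<Prod>i\<in>A. real (n i)) * (\<Sum>i\<in>A. real (n i) + 1) / 2"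
    using assms
  proof (induction A rule: finite_induct)
    case (insert x A)
    then show ?case
      by (simp add: fps_mult_nth shifted_series_nth_0 shifted_series_nth_1 * del: sum.distrib)
        (simp add: field_simps del: sum.distrib)
  qed simp
qed

lemma numerator_series_shift:
  "W d * numerator_series A n = fps_X ^ card A * (W d * (\<Prod>i\<in>A. shifted_series (n i)))"
  by (simp add: numerator_series_def shifted_series prod.distrib)

text \<open>Accounts for the restriction to \<open>k \<ge> r\<close> in the theorem: below
  \<open>r\<close> the coefficients of \<open>\<Phi>\<^sub>d\<close> vanish.\<close>

lemma numerator_series_low:
  "k < card A \<Longrightarrow> fps_nth (W d * numerator_series A n) k = 0"
  unfolding numerator_series_shift by (simp add: fps_X_power_mult_nth)

text \<open>The product of the shifted series contributes half the sum of the
  \<open>n i + 1\<close>, the factor \<open>W d\<close> contributes \<open>- d\<close>. For positive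
  \<open>n i\<close> the sign decides the upper bound on \<open>d\<close> for the ideal.\<close>

lemma numerator_series_second:
  assumes "finite A"
  shows "fps_nth (W d * numerator_series A n) (Suc (card A))
    = (\<Prod>i\<in>A. real (n i)) * ((\<Sum>i\<in>A. real (n i)) + real (card A) - 2 * of_int d) / 2"
proof -
  have "fps_nth (fps_X ^ m * F) (Suc m) = fps_nth F (Suc 0)" for m and F :: "real fps"
    by (simp add: fps_X_power_mult_nth)
  then have "fps_nth (W d * numerator_series A n) (Suc (card A))
      = fps_nth (W d * (\<Prod>i\<in>A. shifted_series (n i))) (Suc 0)"
    unfolding numerator_series_shift .
  also have "\<dots> = fps_nth (\<Prod>i\<in>A. shifted_series (n i)) (Suc 0)
      - of_int d * fps_nth (\<Prod>i\<in>A. shifted_series (n i)) 0"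
    by (simp add: fps_mult_nth W_nth_1)
  finally show ?thesis
    unfolding shifted_series_prod[OF assms] by (simp add: sum.distrib field_simps)
qed

text \<open>When \<open>d\<close> is the sum of the \<open>c i\<close>, each factor can be given its
  own power of \<open>1 - t\<close>. For complementary halves \<open>c i\<close> and
  \<open>e i\<close> of \<open>n i\<close> the right-hand factors are those of
  \<open>nonneg_fps_factor\<close>.\<close>

lemma numerator_series_lower:
  "W (\<Sum>i\<in>A. int (c i)) * (\<Prod>i\<in>A. W (- int (n i)) - 1)
    = (\<Prod>i\<in>A. W (int (c i) - int (n i)) - W (int (c i)))"
proof -
  have "W (int (c i)) * (W (- int (n i)) - 1) = W (int (c i) - int (n i)) - W (int (c i))" for i
    using W_add[of "int (c i)" "- int (n i)"] by (simp add: right_diff_distrib)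
  then show ?thesis
    by (simp only: W_sum flip: prod.distrib)
qed

section \<open>Squarefree monomials in ideals generated by variables\<close>

lemma prod_var:
  "(\<Prod>i\<in>T. var i :: 'k::field mpoly) = Poly_Mapping.single (\<Sum>i\<in>T. Poly_Mapping.single i (Suc 0)) 1"
  by (induction T rule: infinite_finite_induct) (simp_all add: var_def mult_single)

lemma keys_sum_single:
  assumes "finite T"
  shows "Poly_Mapping.keys (\<Sum>i\<in>T. Poly_Mapping.single i (Suc 0)) = T"
  using assms by (auto simp: in_keys_iff lookup_sum lookup_single when_def split: if_splits)

lemma prod_var_inject:
  assumes "finite T" "finite U" "(\<Prod>i\<in>T. var i :: 'k::field mpoly) = (\<Prod>i\<in>U. var i)"
  shows "T = U"
proof -
  have "Poly_Mapping.keys (\<Prod>i\<in>T. var i :: 'k mpoly) = {\<Sum>i\<in>T. Poly_Mapping.single i (Suc 0)}" for T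
    by (simp add: prod_var)
  then have "(\<Sum>i\<in>T. Poly_Mapping.single i (Suc 0)) = (\<Sum>i\<in>U. Poly_Mapping.single i (Suc 0))"
    by (metis assms(3) singleton_inject)
  then show ?thesis
    using keys_sum_single assms(1,2) by metis
qed

lemma prod_var_nonzero: "(\<Prod>i\<in>T. var i :: 'k::field mpoly) \<noteq> 0"
  unfolding prod_var by (metis lookup_single_eq lookup_zero zero_neq_one)

lemma prod_var_in_carrier:
  assumes "T \<subseteq> {1..p}"
  shows "(\<Prod>i\<in>T. var i :: 'k::field mpoly) \<in> carrier (poly_ring p)"
  using assms finite_subset[OF assms] by (simp add: poly_ring_def prod_var keys_sum_single)

text \<open>For \<open>S\<close> within \<open>{1..p}\<close> this ideal contains the variables
  indexed by \<open>S\<close>, hence bounds the ideal they generate from above, and membership in it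
  can be read off the exponent vectors.\<close>

lemma ideal_meeting_support:
  "ideal {f \<in> carrier (poly_ring p). \<forall>m\<in>Poly_Mapping.keys f. Poly_Mapping.keys m \<inter> S \<noteq> {}}
     (poly_ring p :: 'k::field mpoly ring)"
    (is "ideal ?I ?R")
proof -
  interpret cring ?R by (rule cring_poly_ring)
  have ops: "x \<otimes>\<^bsub>?R\<^esub> y = x * y" "x \<oplus>\<^bsub>?R\<^esub> y = x + y" "\<zero>\<^bsub>?R\<^esub> = 0" for x y
    by (simp_all add: poly_ring_def)
  have mult: "x * a \<in> ?I" if a: "a \<in> ?I" and x: "x \<in> carrier ?R" for a x
  proof -
    have "Poly_Mapping.keys m \<inter> S \<noteq> {}" if m: "m \<in> Poly_Mapping.keys (x * a)" for m
    proof -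
      obtain u v where uv: "m = u + v" "v \<in> Poly_Mapping.keys a"
        using m keys_mult[of x a] by blast
      then have "Poly_Mapping.keys v \<subseteq> Poly_Mapping.keys m"
        by (auto simp: in_keys_iff lookup_add)
      then show ?thesis using a uv by blast
    qed
    moreover have "x * a \<in> carrier ?R"
      using m_closed[of x a] x a by (simp add: ops)
    ultimately show ?thesis by blast
  qed
  show ?thesis
  proof (rule idealI)
    show "subgroup ?I (add_monoid ?R)"
    proof (rule add.subgroupI)
      show "?I \<noteq> {}" using zero_closed by (auto simp: ops)
      show "\<ominus>\<^bsub>?R\<^esub> a \<in> ?I" if "a \<in> ?I" for a
      proof -
        have "a \<in> carrier ?R" using that by simp
        then have "\<ominus>\<^bsub>?R\<^esub> a + a = 0" using l_neg[of a] by (simp add: ops)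
        then have "\<ominus>\<^bsub>?R\<^esub> a = - a" by (simp add: eq_neg_iff_add_eq_0)
        then show ?thesis using that a_inv_closed[of a] by (auto simp: keys_minus)
      qed
      show "a \<oplus>\<^bsub>?R\<^esub> b \<in> ?I" if "a \<in> ?I" "b \<in> ?I" for a b
        using that a_closed[of a b] keys_add[of a b] by (auto simp: ops)
    qed auto
  qed (use mult ring_axioms in \<open>simp_all add: ops mult.commute\<close>)
qed

text \<open>Forwards, minimality of the generated ideal is applied to the explicit ideal of
  \<open>ideal_meeting_support\<close>; backwards, a variable with index in
  \<open>T \<inter> S\<close> is split off the monomial.\<close>

lemma prod_var_in_genideal_iff:
  assumes T: "T \<subseteq> {1..p}" and S: "S \<subseteq> {1..p}"
  shows "(\<Prod>i\<in>T. var i :: 'k::field mpoly) \<in> genideal (poly_ring p) (var ` S) \<longleftrightarrow> T \<inter> S \<noteq> {}"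
    (is "?m \<in> genideal ?R _ \<longleftrightarrow> _")
proof
  interpret cring ?R by (rule cring_poly_ring)
  have fin: "finite T" using T finite_subset by blast
  have var_carrier: "var i \<in> carrier ?R" if "i \<in> {1..p}" for i
    using prod_var_in_carrier[of "{i}" p] that by simp
  {
    assume "?m \<in> genideal ?R (var ` S)"
    moreover have "var i \<in> {f \<in> carrier ?R. \<forall>m\<in>Poly_Mapping.keys f. Poly_Mapping.keys m \<inter> S \<noteq> {}}"
      if "i \<in> S" for i
      using that S var_carrier by (auto simp: var_def)
    then have "genideal ?R (var ` S)
        \<subseteq> {f \<in> carrier ?R. \<forall>m\<in>Poly_Mapping.keys f. Poly_Mapping.keys m \<inter> S \<noteq> {}}"
      by (intro genideal_minimal ideal_meeting_support) blast
    ultimately show "T \<inter> S \<noteq> {}"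
      using fin by (auto simp: prod_var keys_sum_single)
  next
    assume "T \<inter> S \<noteq> {}"
    then obtain i where i: "i \<in> T" "i \<in> S" by blast
    have sub: "var ` S \<subseteq> carrier ?R" using S var_carrier by blast
    interpret Id: ideal "genideal ?R (var ` S)" ?R by (rule genideal_ideal[OF sub])
    have "var i \<in> genideal ?R (var ` S)"
      using genideal_self[OF sub] i by blast
    moreover have "(\<Prod>i\<in>T - {i}. var i) \<in> carrier ?R"
      using T by (intro prod_var_in_carrier) blast
    ultimately have "var i \<otimes>\<^bsub>?R\<^esub> (\<Prod>i\<in>T - {i}. var i) \<in> genideal ?R (var ` S)"
      by (rule Id.I_r_closed)
    then show "?m \<in> genideal ?R (var ` S)"
      using fin i by (simp add: prod.remove poly_ring_def)
  }
qed

lemma alpha_eq_card: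
  "alpha p B A j
    = card {T. T \<subseteq> {1..p} \<and> card T = j \<and> (\<Prod>i\<in>T. var i :: 'k::field mpoly) \<in> B - A}"
proof -
  let ?C = "{T. T \<subseteq> {1..p} \<and> card T = j \<and> (\<Prod>i\<in>T. var i :: 'k mpoly) \<in> B - A}"
  have "sqfree_monomials p j \<inter> (B - A) = (\<lambda>T. \<Prod>i\<in>T. var i) ` ?C"
    by (auto simp: sqfree_monomials_def)
  moreover have "inj_on (\<lambda>T. \<Prod>i\<in>T. var i :: 'k mpoly) ?C"
    by (rule inj_onI) (metis (no_types, lifting) prod_var_inject finite_atLeastAtMost finite_subset mem_Collect_eq)
  ultimately show ?thesis by (simp add: alpha_def card_image)
qed

section \<open>Counting squarefree monomials by inclusion-exclusion\<close>

text \<open>The indicator of meeting every \<open>B i\<close> is a product of factors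
  \<open>1 - [T misses B i]\<close>. After multiplying out, the term of \<open>J\<close> counts the
  sets of size \<open>j\<close> in the complement of a union, whose size is a sum by
  disjointness.\<close>

lemma card_hitting_sets:
  assumes fin: "finite A" "finite V"
    and sub: "\<And>i. i \<in> A \<Longrightarrow> B i \<subseteq> V"
    and disj: "disjoint_family_on B A"
  shows "int (card {T. T \<subseteq> V \<and> card T = j \<and> (\<forall>i\<in>A. T \<inter> B i \<noteq> {})})
    = (\<Sum>J\<in>Pow A. (-1) ^ card J * int ((card V - (\<Sum>i\<in>J. card (B i))) choose j))"
proof -
  let ?P = "{T. T \<subseteq> V \<and> card T = j}"
  have finP: "finite ?P" using fin by simp
  have "int (card {T. T \<subseteq> V \<and> card T = j \<and> (\<forall>i\<in>A. T \<inter> B i \<noteq> {})})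
      = (\<Sum>T\<in>?P. of_bool (\<forall>i\<in>A. T \<inter> B i \<noteq> {}))"
    using finP by (simp add: Int_def conj_assoc flip: of_nat_sum)
  also have "\<dots> = (\<Sum>T\<in>?P. \<Prod>i\<in>A. 1 - of_bool (T \<inter> B i = {}))"
  proof (rule sum.cong)
    fix T
    show "of_bool (\<forall>i\<in>A. T \<inter> B i \<noteq> {}) = (\<Prod>i\<in>A. 1 - of_bool (T \<inter> B i = {}) :: int)"
      using fin by (auto intro!: prod.neutral[symmetric] prod_zero[symmetric])
  qed simp
  also have "\<dots> = (\<Sum>T\<in>?P. \<Sum>J\<in>Pow A. (-1) ^ card J * (\<Prod>i\<in>J. of_bool (T \<inter> B i = {})))"
    by (simp add: prod_diff_conv_sum[OF fin(1)])
  also have "\<dots> = (\<Sum>J\<in>Pow A. (-1) ^ card J * (\<Sum>T\<in>?P. \<Prod>i\<in>J. of_bool (T \<inter> B i = {})))"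
    by (subst sum.swap) (simp add: sum_distrib_left)
  also have "\<dots> = (\<Sum>J\<in>Pow A. (-1) ^ card J * int ((card V - (\<Sum>i\<in>J. card (B i))) choose j))"
  proof (rule sum.cong)
    fix J assume "J \<in> Pow A"
    then have J: "J \<subseteq> A" "finite J" using fin finite_subset by auto
    have "(\<Prod>i\<in>J. of_bool (T \<inter> B i = {})) = (of_bool (T \<inter> (\<Union>i\<in>J. B i) = {}) :: int)" for T
    proof -
      have "T \<inter> (\<Union>i\<in>J. B i) = {} \<longleftrightarrow> (\<forall>i\<in>J. T \<inter> B i = {})" by blast
      then show ?thesis using J by (auto intro!: prod_zero)
    qed
    then have "(\<Sum>T\<in>?P. \<Prod>i\<in>J. of_bool (T \<inter> B i = {})) = int (card (?P \<inter> {T. T \<inter> (\<Union>i\<in>J. B i) = {}}))"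
      using finP by simp
    also have "?P \<inter> {T. T \<inter> (\<Union>i\<in>J. B i) = {}} = {T. T \<subseteq> V - (\<Union>i\<in>J. B i) \<and> card T = j}"
      by blast
    also have "card \<dots> = card (V - (\<Union>i\<in>J. B i)) choose j"
      using fin by (simp add: n_subsets)
    also have "card (V - (\<Union>i\<in>J. B i)) = card V - card (\<Union>i\<in>J. B i)"
      using J sub fin by (intro card_Diff_subset) (auto intro: finite_subset)
    also have "card (\<Union>i\<in>J. B i) = (\<Sum>i\<in>J. card (B i))"
    proof (rule card_UN_disjoint)
      show "\<forall>i\<in>J. finite (B i)" using J sub fin by (meson finite_subset subsetD)
      show "\<forall>i\<in>J. \<forall>j\<in>J. i \<noteq> j \<longrightarrow> B i \<inter> B j = {}"
        using J disj unfolding disjoint_family_on_def by blast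
    qed fact
    finally show "(-1) ^ card J * (\<Sum>T\<in>?P. \<Prod>i\<in>J. of_bool (T \<inter> B i = {}))
        = (-1) ^ card J * int ((card V - (\<Sum>i\<in>J. card (B i))) choose j)"
      by simp
  qed simp
  finally show ?thesis .
qed

lemma card_block:
  assumes "i \<ge> 1"
  shows "card (block n i) = n i"
proof -
  from assms have "(\<Sum>l=1..i. n l) = (\<Sum>l=1..<i. n l) + n i"
    by (simp add: sum.last_plus atLeastLessThanSuc_atLeastAtMost[symmetric])
  then show ?thesis by (simp add: block_def)
qed

lemma block_subset:
  assumes "i \<le> r"
  shows "block n i \<subseteq> {1..\<Sum>l=1..r. n l}"
proof -
  from assms have "(\<Sum>l=1..i. n l) \<le> (\<Sum>l=1..r. n l)"
    by (intro sum_mono2) auto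
  then show ?thesis by (auto simp: block_def)
qed

lemma disjoint_family_block: "disjoint_family_on (block n) A"
proof -
  have "block n i \<inter> block n j = {}" if "i < j" for i j
  proof -
    have "(\<Sum>l=1..i. n l) \<le> (\<Sum>l=1..<j. n l)"
      using that by (intro sum_mono2) auto
    then show ?thesis by (auto simp: block_def)
  qed
  then show ?thesis
    unfolding disjoint_family_on_def by (metis Int_commute linorder_neqE_nat)
qed

lemma prod_var_in_intersection_iff:
  assumes N: "N = (\<Sum>i=1..r. n i)" and T: "T \<subseteq> {1..N}"
  shows "(\<Prod>i\<in>T. var i :: 'k::field mpoly) \<in> (\<Inter>i\<in>{1..r}. genideal (poly_ring N) (var ` block n i))
    \<longleftrightarrow> (\<forall>i\<in>{1..r}. T \<inter> block n i \<noteq> {})"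
proof -
  have "block n i \<subseteq> {1..N}" if "i \<in> {1..r}" for i
    using block_subset[of i r n] that unfolding N by simp
  then show ?thesis
    using prod_var_in_genideal_iff[OF T, where 'k = 'k] by simp
qed

lemma alpha_intersection:
  fixes I :: "'k::field mpoly set"
  assumes N: "N = (\<Sum>i=1..r. n i)"
    and I: "I = (\<Inter>i\<in>{1..r}. genideal (poly_ring N) (var ` block n i))"
  shows "int (alpha N I {0} j)
    = (\<Sum>J\<in>Pow {1..r}. (-1) ^ card J * int ((N - (\<Sum>i\<in>J. n i)) choose j))"
proof -
  have "alpha N I {0} j
      = card {T. T \<subseteq> {1..N} \<and> card T = j \<and> (\<forall>i\<in>{1..r}. T \<inter> block n i \<noteq> {})}"
    unfolding alpha_eq_card I using prod_var_in_intersection_iff[OF N, where 'k = 'k]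
    by (intro arg_cong[where f = card] Collect_cong) (metis Diff_iff prod_var_nonzero singletonD)
  then have "int (alpha N I {0} j)
      = (\<Sum>J\<in>Pow {1..r}. (-1) ^ card J * int ((card {1..N} - (\<Sum>i\<in>J. card (block n i))) choose j))"
    using block_subset[of _ r n] unfolding N
    by (simp only:) (intro card_hitting_sets disjoint_family_block; simp)
  also have "\<dots> = (\<Sum>J\<in>Pow {1..r}. (-1) ^ card J * int ((N - (\<Sum>i\<in>J. n i)) choose j))"
  proof (rule sum.cong)
    fix J assume "J \<in> Pow {1..r}"
    then have "(\<Sum>i\<in>J. card (block n i)) = (\<Sum>i\<in>J. n i)"
      by (intro sum.cong card_block) auto
    then show "(-1) ^ card J * int ((card {1..N} - (\<Sum>i\<in>J. card (block n i))) choose j)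
        = (-1) ^ card J * int ((N - (\<Sum>i\<in>J. n i)) choose j)"
      by simp
  qed simp
  finally show ?thesis .
qed

text \<open>The explicit count serves the upper bound on \<open>d\<close>; the complementary count
  reduces \<open>beta\<close> of the quotient to \<open>beta\<close> of the ideal.\<close>

lemma alpha_quotient:
  fixes I :: "'k::field mpoly set"
  assumes N: "N = (\<Sum>i=1..r. n i)"
    and I: "I = (\<Inter>i\<in>{1..r}. genideal (poly_ring N) (var ` block n i))"
  shows "alpha N (carrier (poly_ring N)) I j
      = card {T. T \<subseteq> {1..N} \<and> card T = j \<and> (\<exists>i\<in>{1..r}. T \<inter> block n i = {})}"
    and "int (alpha N (carrier (poly_ring N)) I j) = int (N choose j) - int (alpha N I {0} j)"
proof -
  show "alpha N (carrier (poly_ring N)) I j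
      = card {T. T \<subseteq> {1..N} \<and> card T = j \<and> (\<exists>i\<in>{1..r}. T \<inter> block n i = {})}"
    unfolding alpha_eq_card I using prod_var_in_intersection_iff[OF N, where 'k = 'k]
    by (intro arg_cong[where f = card] Collect_cong) (metis Diff_iff prod_var_in_carrier)
  let ?P = "{T. T \<subseteq> {1..N} \<and> card T = j}"
  let ?m = "\<lambda>T. \<Prod>i\<in>T. var i :: 'k mpoly"
  have fin: "finite ?P" by simp
  have "int (N choose j) = int (card ?P)"
    by (simp add: n_subsets)
  also have "?P = {T \<in> ?P. ?m T \<in> I} \<union> {T \<in> ?P. ?m T \<notin> I}" by blast
  also have "card \<dots> = card {T \<in> ?P. ?m T \<in> I} + card {T \<in> ?P. ?m T \<notin> I}"
    using fin by (intro card_Un_disjoint) auto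
  also have "{T \<in> ?P. ?m T \<in> I} = {T. T \<subseteq> {1..N} \<and> card T = j \<and> ?m T \<in> I - {0}}"
    using prod_var_nonzero[where 'k = 'k] by auto
  also have "{T \<in> ?P. ?m T \<notin> I} = {T. T \<subseteq> {1..N} \<and> card T = j \<and> ?m T \<in> carrier (poly_ring N) - I}"
    using prod_var_in_carrier[where 'k = 'k] by auto
  finally show "int (alpha N (carrier (poly_ring N)) I j) = int (N choose j) - int (alpha N I {0} j)"
    by (simp add: alpha_eq_card)
qed

section \<open>The numbers \<open>beta\<close> as coefficients of power series\<close>

text \<open>By linearity the transform acts on each inclusion-exclusion term separately; there
  \<open>binomial_convolution\<close> applies with \<open>m = N - (\<Sum>i\<in>J. n i)\<close>, and
  the results recombine to the expanded product.\<close>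

lemma beta_intersection:
  fixes I :: "'k::field mpoly set"
  assumes N: "N = (\<Sum>i=1..r. n i)"
    and I: "I = (\<Inter>i\<in>{1..r}. genideal (poly_ring N) (var ` block n i))"
    and k: "k \<le> d"
  shows "real_of_int (beta N I {0} d k) = fps_nth (W (int d) * numerator_series {1..r} n) k"
proof -
  have "real_of_int (beta N I {0} d k) = (\<Sum>j=0..k. (-1) ^ (k - j) * real ((d - j) choose (k - j)) *
      (\<Sum>J\<in>Pow {1..r}. (-1) ^ card J * real ((N - (\<Sum>i\<in>J. n i)) choose j)))"
    by (simp add: beta_def alpha_intersection[OF N I])
  also have "\<dots> = (\<Sum>J\<in>Pow {1..r}. (-1) ^ card J * (\<Sum>j=0..k. (-1) ^ (k - j) *
      real ((d - j) choose (k - j)) * real ((N - (\<Sum>i\<in>J. n i)) choose j)))"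
    unfolding sum_distrib_left by (subst sum.swap) (simp add: mult_ac)
  also have "\<dots> = (\<Sum>J\<in>Pow {1..r}. (-1) ^ card J * fps_nth (W (int d - int (N - (\<Sum>i\<in>J. n i)))) k)"
    by (simp only: binomial_convolution[OF k])
  also have "\<dots> = fps_nth (W (int d) * numerator_series {1..r} n) k"
    unfolding numerator_series_expand[OF finite_atLeastAtMost] fps_sum_nth
  proof (rule sum.cong)
    fix J assume "J \<in> Pow {1..r}"
    then have "(\<Sum>i\<in>J. n i) \<le> N"
      unfolding N by (intro sum_mono2) auto
    then have eq: "int d - int (N - (\<Sum>i\<in>J. n i)) = int d + (\<Sum>i\<in>J. int (n i)) - (\<Sum>i=1..r. int (n i))"
      by (simp add: N)
    show "(-1) ^ card J * fps_nth (W (int d - int (N - (\<Sum>i\<in>J. n i)))) k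
      = fps_nth ((-1) ^ card J * W (int d + (\<Sum>i\<in>J. int (n i)) - (\<Sum>i=1..r. int (n i)))) k"
      unfolding eq by (cases "even (card J)") simp_all
  qed simp
  finally show ?thesis .
qed

lemma beta_quotient:
  fixes I :: "'k::field mpoly set"
  assumes N: "N = (\<Sum>i=1..r. n i)"
    and I: "I = (\<Inter>i\<in>{1..r}. genideal (poly_ring N) (var ` block n i))"
    and k: "k \<le> d"
  shows "real_of_int (beta N (carrier (poly_ring N)) I d k)
    = fps_nth (W (int d - int N) - W (int d) * numerator_series {1..r} n) k"
proof -
  have "real_of_int (beta N (carrier (poly_ring N)) I d k)
    = (\<Sum>j=0..k. (-1) ^ (k - j) * real ((d - j) choose (k - j)) * real (N choose j))
      - real_of_int (beta N I {0} d k)"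
    by (simp add: beta_def alpha_quotient(2)[OF N I] right_diff_distrib sum_subtractf)
  then show ?thesis
    by (simp add: binomial_convolution[OF k] beta_intersection[OF N I k])
qed

text \<open>After exchanging the sums, \<open>alpha p B A j\<close> is multiplied by the alternating
  sum of row \<open>d - j\<close> of Pascal's triangle, which vanishes unless
  \<open>j = d\<close>.\<close>

lemma sum_beta: "(\<Sum>k=0..d. beta p B A d k) = int (alpha p B A d)"
proof -
  let ?t = "\<lambda>k j. (-1) ^ (k - j) * int ((d - j) choose (k - j)) * int (alpha p B A j)"
  have "(\<Sum>k=0..d. beta p B A d k) = (\<Sum>k\<in>{0..d}. \<Sum>j\<in>{j \<in> {0..d}. j \<le> k}. ?t k j)"
    unfolding beta_def by (intro sum.cong) auto
  also have "\<dots> = (\<Sum>j\<in>{0..d}. \<Sum>k\<in>{k \<in> {0..d}. j \<le> k}. ?t k j)"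
    by (rule sum.swap_restrict) simp_all
  also have "\<dots> = (\<Sum>j\<in>{0..d}. if j = d then int (alpha p B A j) else 0)"
  proof (rule sum.cong)
    fix j assume j: "j \<in> {0..d}"
    have "(\<Sum>k\<in>{k \<in> {0..d}. j \<le> k}. ?t k j)
        = (\<Sum>i\<le>d - j. (-1) ^ i * int ((d - j) choose i) * int (alpha p B A j))"
      using j by (intro sum.reindex_bij_witness[of _ "\<lambda>i. i + j" "\<lambda>k. k - j"]) auto
    also have "\<dots> = (\<Sum>i\<le>d - j. (-1) ^ i * int ((d - j) choose i)) * int (alpha p B A j)"
      by (simp add: sum_distrib_right)
    also have "\<dots> = (if j = d then int (alpha p B A j) else 0)"
      using j choose_alternating_sum[of "d - j", where 'a = int] by simp
    finally show "(\<Sum>k\<in>{k \<in> {0..d}. j \<le> k}. ?t k j) = (if j = d then int (alpha p B A j) else 0)" .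
  qed simp
  finally show ?thesis by simp
qed

text \<open>Common frame for both claims, with \<open>Q\<close> the sign condition of the theorem.
  By \<open>low\<close> the maximum defining \<open>hdepth\<close> is at least \<open>d0\<close>,
  and by \<open>upper\<close> at most \<open>u\<close>. Conversely an integer between
  \<open>d0\<close> and \<open>u\<close> is a natural number at most \<open>p\<close>, so with
  \<open>Q\<close> it competes in that maximum.\<close>

lemma is_maximum_hdepth:
  fixes A B :: "'k::field mpoly set"
  assumes low: "d0 \<le> p" "\<And>k. k \<le> d0 \<Longrightarrow> 0 \<le> beta p B A d0 k"
    and upper: "\<And>d. d \<le> p \<Longrightarrow> \<forall>k\<le>d. 0 \<le> beta p B A d k \<Longrightarrow> int d \<le> u"
    and u: "u \<le> int p"
    and Q: "\<And>d. d \<le> p \<Longrightarrow> Q (int d) \<longleftrightarrow> (\<forall>k\<le>d. 0 \<le> beta p B A d k)"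
  shows "is_maximum (int (hdepth p B A)) {d. int d0 \<le> d \<and> d \<le> u \<and> Q d}"
proof -
  define H where "H = {d \<in> {0..p}. \<forall>k\<le>d. 0 \<le> beta p B A d k}"
  have hdepth: "hdepth p B A = Max H" by (simp add: hdepth_def H_def)
  have fin: "finite H" by (simp add: H_def)
  have "d0 \<in> H" using low by (simp add: H_def)
  then have mem: "Max H \<in> H" and ge: "d0 \<le> Max H"
    using fin by (auto intro: Max_in)
  have "int d \<le> u" "Q (int d)" if "d \<in> H" for d
    using that upper Q by (auto simp: H_def)
  moreover have "d \<le> int (Max H)" if "int d0 \<le> d" "d \<le> u" "Q d" for d
  proof -
    obtain d' where d': "d = int d'" using \<open>int d0 \<le> d\<close> by (metis nonneg_int_cases of_nat_0_le_iff order_trans)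
    then have "d' \<in> H" using that u Q[of d'] by (simp add: H_def)
    then show ?thesis using fin d' by simp
  qed
  ultimately show ?thesis
    using mem ge unfolding is_maximum_def hdepth by auto
qed

lemma ceiling_half: "\<lceil>real m / 2\<rceil> = int (Suc m div 2)"
  by (rule ceiling_unique) (cases "even m"; auto elim!: evenE oddE)+

theorem proposition3p8:
  fixes n :: "nat \<Rightarrow> nat" and r N :: nat and I :: "'k::field mpoly set"
  assumes r_pos: "r \<ge> 1"
    and n_pos: "\<And>i. i \<in> {1..r} \<Longrightarrow> n i > 0"
    and N_eq: "N = (\<Sum>i=1..r. n i)"
    and I_eq: "I = (\<Inter>i\<in>{1..r}. genideal (poly_ring N) (var ` block n i))"
  shows
    "is_maximum (int (hdepth N I {0}))
       {d :: int.
          (\<Sum>i=1..r. \<lceil>real (n i) / 2\<rceil>) \<le> d \<and>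
          d \<le> \<lfloor>(real N + real r) / 2\<rfloor> \<and>
          (\<forall>k::nat. r \<le> k \<and> int k \<le> d \<longrightarrow>
             (\<Sum>J\<in>Pow {1..r}. (-1) ^ card J *
                (real_of_int (int N - (\<Sum>i\<in>J. int (n i)) - d + int k - 1) gchoose k)) \<ge> 0)}
     \<and>
     is_maximum (int (hdepth N (carrier (poly_ring N)) I))
       {d :: int.
          (\<Sum>i=1..r. \<lceil>real (n i) / 2\<rceil>) - Min ((\<lambda>i. \<lceil>real (n i) / 2\<rceil>) ` {1..r}) \<le> d \<and>
          d \<le> int N - int (Min (n ` {1..r})) \<and>
          (\<forall>k::nat. r \<le> k \<and> int k \<le> d \<longrightarrow>
             (\<Sum>J\<in>Pow {1..r} - {{}}. (-1) ^ (card J + 1) *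
                (real_of_int (int N - (\<Sum>i\<in>J. int (n i)) - d + int k - 1) gchoose k)) \<ge> 0)}"
proof
  define c where "c i = Suc (n i) div 2" for i
  define e where "e i = n i div 2" for i
  have ce: "c i + e i = n i" "c i \<le> Suc (e i)" for i
    by (simp_all add: c_def e_def)
  define F where "F d = W d * numerator_series {1..r} n" for d :: int
  have F_nth: "fps_nth (F d) k = (\<Sum>J\<in>Pow {1..r}. (-1) ^ card J *
      (real_of_int (int N - (\<Sum>i\<in>J. int (n i)) - d + int k - 1) gchoose k))" for d k
    unfolding F_def by (subst numerator_series_nth) (simp_all add: N_eq)
  have beta_I: "real_of_int (beta N I {0} d k) = fps_nth (F (int d)) k" if "k \<le> d" for d k
    unfolding F_def by (rule beta_intersection[OF N_eq I_eq that])
  have beta_Q: "real_of_int (beta N (carrier (poly_ring N)) I d k)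
      = fps_nth (W (int d - int N)) k - fps_nth (F (int d)) k" if "k \<le> d" for d k
    unfolding F_def by (simp add: beta_quotient[OF N_eq I_eq that])
  have ceil_sum: "(\<Sum>i=1..r. \<lceil>real (n i) / 2\<rceil>) = int (\<Sum>i=1..r. c i)"
    by (simp only: ceiling_half c_def of_nat_sum)
  have r_le_N: "r \<le> N"
    using sum_mono[of "{1..r}" "\<lambda>_. 1" n] n_pos unfolding N_eq by (simp add: Suc_leI)
  have F_low: "fps_nth (F d) k = 0" if "k < r" for d k
    unfolding F_def using that by (intro numerator_series_low) simp

  \<comment> \<open>The depth of the ideal\<close>
  show "is_maximum (int (hdepth N I {0}))
       {d :: int.
          (\<Sum>i=1..r. \<lceil>real (n i) / 2\<rceil>) \<le> d \<and>
          d \<le> \<lfloor>(real N + real r) / 2\<rfloor> \<and>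
          (\<forall>k::nat. r \<le> k \<and> int k \<le> d \<longrightarrow>
             (\<Sum>J\<in>Pow {1..r}. (-1) ^ card J *
                (real_of_int (int N - (\<Sum>i\<in>J. int (n i)) - d + int k - 1) gchoose k)) \<ge> 0)}"
    unfolding ceil_sum F_nth[symmetric]
  proof (rule is_maximum_hdepth)
    have "c i \<le> n i" for i using ce(1)[of i] by simp
    then show "(\<Sum>i=1..r. c i) \<le> N" unfolding N_eq by (rule sum_mono)
    fix k assume k: "k \<le> (\<Sum>i=1..r. c i)"
    have "F (int (\<Sum>i=1..r. c i)) = (\<Prod>i=1..r. W (- int (e i)) - W (int (c i)))"
    proof -
      have "int (c i) - int (n i) = - int (e i)" for i using ce(1)[of i] by simp
      then show ?thesis
        unfolding F_def numerator_series_def of_nat_sum by (subst numerator_series_lower) simp_all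
    qed
    moreover have "nonneg_fps (\<Prod>i=1..r. W (- int (e i)) - W (int (c i)))"
      by (intro nonneg_fps_prod nonneg_fps_factor ce)
    ultimately have "0 \<le> real_of_int (beta N I {0} (\<Sum>i=1..r. c i) k)"
      unfolding beta_I[OF k] by (simp add: nonneg_fps_def)
    then show "0 \<le> beta N I {0} (\<Sum>i=1..r. c i) k" by simp
  next
    show "\<lfloor>(real N + real r) / 2\<rfloor> \<le> int N"
      using r_le_N by (simp add: floor_le_iff)
  next
    fix d assume beta: "\<forall>k\<le>d. 0 \<le> beta N I {0} d k"
    have "2 * real d \<le> real N + real r"
    proof (cases "Suc r \<le> d")
      case False
      then show ?thesis using r_le_N by simp
    next
      case True
      then have "0 \<le> fps_nth (F (int d)) (Suc r)"
        using beta by (simp flip: beta_I)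
      also have "\<dots> = (\<Prod>i=1..r. real (n i)) * (real N + real r - 2 * real d) / 2"
        using numerator_series_second[of "{1..r}" "int d" n] by (simp add: F_def N_eq)
      finally show ?thesis
        using n_pos prod_pos[of "{1..r}" "\<lambda>i. real (n i)"] by (simp add: zero_le_mult_iff)
    qed
    then show "int d \<le> \<lfloor>(real N + real r) / 2\<rfloor>"
      by (simp add: le_floor_iff)
  next
    fix d
    have "0 \<le> fps_nth (F (int d)) k \<longleftrightarrow> 0 \<le> beta N I {0} d k" if "k \<le> d" for k
      using that by (simp flip: beta_I)
    moreover have "0 \<le> fps_nth (F (int d)) k" if "k < r" for k
      using that by (simp add: F_low)
    ultimately show "(\<forall>k. r \<le> k \<and> int k \<le> int d \<longrightarrow> 0 \<le> fps_nth (F (int d)) k)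
        \<longleftrightarrow> (\<forall>k\<le>d. 0 \<le> beta N I {0} d k)"
      by (metis not_le of_nat_le_iff)
  qed

  \<comment> \<open>The depth of the quotient\<close>
  let ?A = "{1..r}"
  define mu where "mu = Min (n ` ?A)"
  have "mu \<in> n ` ?A" unfolding mu_def using r_pos by (intro Min_in) auto
  then obtain a where a: "a \<in> ?A" "mu = n a" by blast
  have mu_le: "mu \<le> n i" if "i \<in> ?A" for i
    unfolding mu_def using that by simp
  \<comment> \<open>Halving and rounding up is monotone, so an index minimizing \<open>n\<close>
    also minimizes \<open>c\<close>.\<close>
  have "Min ((\<lambda>i. \<lceil>real (n i) / 2\<rceil>) ` ?A) = int (c a)"
    unfolding ceiling_half
  proof (rule Min_eqI)
    show "int (c a) \<le> y" if "y \<in> (\<lambda>i. int (Suc (n i) div 2)) ` ?A" for y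
      using that mu_le by (auto simp: a c_def intro!: div_le_mono)
    show "int (c a) \<in> (\<lambda>i. int (Suc (n i) div 2)) ` ?A"
      using a by (auto simp: c_def)
  qed simp
  then have ceil_sum_minus: "(\<Sum>i=1..r. \<lceil>real (n i) / 2\<rceil>) - Min ((\<lambda>i. \<lceil>real (n i) / 2\<rceil>) ` ?A)
      = int (\<Sum>i\<in>?A - {a}. c i)"
    unfolding ceil_sum using a by (simp add: sum.remove)
  have mu_le_N: "mu \<le> N"
    unfolding N_eq a(2) using a(1) by (intro member_le_sum) auto
  have N_split: "N = n a + (\<Sum>i\<in>?A - {a}. n i)"
    unfolding N_eq using a by (simp add: sum.remove)
  \<comment> \<open>The signs are opposite to those of \<open>F\<close>, and the omitted empty
    \<open>J\<close> is the coefficient of \<open>W (d - N)\<close>.\<close>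
  have S_eq: "(\<Sum>J\<in>Pow ?A - {{}}. (-1) ^ (card J + 1) *
        (real_of_int (int N - (\<Sum>i\<in>J. int (n i)) - d + int k - 1) gchoose k))
      = fps_nth (W (d - int N)) k - fps_nth (F d) k" for d k
    unfolding F_nth by (subst sum_diff1) (simp_all add: W_nth' sum_negf algebra_simps)

  show "is_maximum (int (hdepth N (carrier (poly_ring N)) I))
       {d :: int.
          (\<Sum>i=1..r. \<lceil>real (n i) / 2\<rceil>) - Min ((\<lambda>i. \<lceil>real (n i) / 2\<rceil>) ` {1..r}) \<le> d \<and>
          d \<le> int N - int (Min (n ` {1..r})) \<and>
          (\<forall>k::nat. r \<le> k \<and> int k \<le> d \<longrightarrow>
             (\<Sum>J\<in>Pow {1..r} - {{}}. (-1) ^ (card J + 1) *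
                (real_of_int (int N - (\<Sum>i\<in>J. int (n i)) - d + int k - 1) gchoose k)) \<ge> 0)}"
    unfolding ceil_sum_minus S_eq mu_def[symmetric]
  proof (rule is_maximum_hdepth)
    let ?d = "\<Sum>i\<in>?A - {a}. c i"
    have "c i \<le> n i" for i using ce(1)[of i] by simp
    then have "?d \<le> (\<Sum>i\<in>?A - {a}. n i)" by (rule sum_mono)
    then show "?d \<le> N" unfolding N_split by simp
    fix k assume k: "k \<le> ?d"
    let ?P = "\<Prod>i\<in>?A - {a}. W (- int (e i)) - W (int (c i))"
    \<comment> \<open>The exponent \<open>?d\<close> lacks \<open>c a\<close>, so the factor of
      \<open>a\<close> stays unbalanced; it is the starting factor of
      \<open>nonneg_fps_product_bound\<close> with \<open>M = n a\<close>.\<close>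
    have F_eq: "F (int ?d) = (W (- int (n a)) - 1) * ?P"
    proof -
      have "int (c i) - int (n i) = - int (e i)" for i using ce(1)[of i] by simp
      moreover have "numerator_series ?A n
          = (W (- int (n a)) - 1) * (\<Prod>i\<in>?A - {a}. W (- int (n i)) - 1)"
        unfolding numerator_series_def using a by (simp add: prod.remove)
      ultimately show ?thesis
        using numerator_series_lower[of c "?A - {a}" n]
        unfolding F_def of_nat_sum by (simp add: mult.left_commute)
    qed
    have "N = n a + (?d + (\<Sum>i\<in>?A - {a}. e i))"
      unfolding N_split by (simp only: sum.distrib[symmetric] ce)
    then have d_eq: "int ?d - int N = - int (n a + (\<Sum>i\<in>?A - {a}. e i))" by simp
    have "nonneg_fps (W (int ?d - int N) - 1 - F (int ?d))"
      unfolding F_eq d_eq by (rule nonneg_fps_product_bound) (simp_all add: ce)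
    \<comment> \<open>The series \<open>1\<close> has nonnegative coefficients, so omitting its
      subtraction preserves the inequality.\<close>
    then have "0 \<le> fps_nth (W (int ?d - int N)) k - fps_nth 1 k - fps_nth (F (int ?d)) k"
      unfolding nonneg_fps_def by (metis fps_sub_nth)
    then have "0 \<le> real_of_int (beta N (carrier (poly_ring N)) I ?d k)"
      unfolding beta_Q[OF k] by (simp split: if_splits)
    then show "0 \<le> beta N (carrier (poly_ring N)) I ?d k" by simp
  next
    show "int N - int mu \<le> int N" by simp
  next
    fix d assume d: "d \<le> N" and beta: "\<forall>k\<le>d. 0 \<le> beta N (carrier (poly_ring N)) I d k"
    \<comment> \<open>Since \<open>r \<ge> 1\<close>, the series \<open>F\<close> has no constant
      term.\<close>
    have "real_of_int (beta N (carrier (poly_ring N)) I d 0) = 1"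
      using beta_Q[of 0 d] F_low[of 0] r_pos by simp
    then have "1 = beta N (carrier (poly_ring N)) I d 0" by simp
    also have "\<dots> \<le> (\<Sum>k=0..d. beta N (carrier (poly_ring N)) I d k)"
      using beta by (intro member_le_sum) auto
    also have "\<dots> = int (alpha N (carrier (poly_ring N)) I d)"
      by (rule sum_beta)
    finally have "alpha N (carrier (poly_ring N)) I d \<noteq> 0" by simp
    then have "{T. T \<subseteq> {1..N} \<and> card T = d \<and> (\<exists>i\<in>?A. T \<inter> block n i = {})} \<noteq> {}"
      unfolding alpha_quotient(1)[OF N_eq I_eq] by (metis card.empty)
    then obtain T i where T: "T \<subseteq> {1..N}" "card T = d" "T \<inter> block n i = {}" and i: "i \<in> ?A"
      by blast
    have sub: "block n i \<subseteq> {1..N}"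
      unfolding N_eq using i by (intro block_subset) simp
    have "d \<le> card ({1..N} - block n i)"
      unfolding T(2)[symmetric] using T by (intro card_mono) auto
    also have "\<dots> = N - n i"
      using sub i by (subst card_Diff_subset) (auto simp: card_block intro: finite_subset)
    finally show "int d \<le> int N - int mu"
      using mu_le[OF i] mu_le_N by linarith
  next
    fix d assume d: "d \<le> N"
    define G where "G k = fps_nth (W (int d - int N)) k - fps_nth (F (int d)) k" for k
    have "0 \<le> G k \<longleftrightarrow> 0 \<le> beta N (carrier (poly_ring N)) I d k" if "k \<le> d" for k
      using that by (simp add: G_def flip: beta_Q)
    \<comment> \<open>Below \<open>r\<close> only the power of \<open>1 - t\<close> remains, and its
      exponent \<open>d - N\<close> is at most \<open>0\<close>.\<close>
    moreover have "0 \<le> G k" if "k < r" for k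
    proof -
      obtain m where "N = d + m" using d le_Suc_ex by blast
      then have "int d - int N = - int m" by simp
      then show ?thesis
        using that by (cases k) (simp_all add: G_def F_low W_neg_nth_Suc)
    qed
    ultimately show "(\<forall>k. r \<le> k \<and> int k \<le> int d \<longrightarrow>
        0 \<le> fps_nth (W (int d - int N)) k - fps_nth (F (int d)) k)
      \<longleftrightarrow> (\<forall>k\<le>d. 0 \<le> beta N (carrier (poly_ring N)) I d k)"
      unfolding G_def by (metis not_le of_nat_le_iff)
  qed
qed

end
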